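(* Let $L=K_1\mathbf e_1+K_2\mathbf e_2$ be a bicomplex extension of $\mathbb{Q}$ of degree $n$, where $K_1,K_2$ are number fields. The ring of integers $\mathcal{O}_L$ of $L$ decomposes uniquely as $$\mathcal{O}_L=\mathcal{O}_{K_1}\mathbf e_1+\mathcal{O}_{K_2}\mathbf e_2.$$ Moreover, $\mathcal{O}_L$ is a free $\mathbb{Z}$-module of rank $n$ and contains $\mathbb{Z}$.
   Context: The bicomplex numbers are the commutative 4-dimensional real algebra $\mathbb{B}=\{x+y\mathbf i+z\mathbf j+t\mathbf k: x,y,z,t\in\mathbb{R}\}$ with $\mathbf i^2=\mathbf k^2=-1$, $\mathbf j^2=1$, $\mathbf i\mathbf j=\mathbf j\mathbf i=\mathbf k$; $\mathbb{C}$ is identified with $\{x+y\mathbf i\}$. Put $\mathbf e_1=\frac{1+\mathbf j}{2}$, $\mathbf e_2=\frac{1-\mathbf j}{2}$; every bicomplex number is uniquely $\gamma_1\mathbf e_1+\gamma_2\mathbf e_2$ with $\gamma_1,\gamma_2\in\mathbb{C}$, and operations are componentwise. Number fields are subfields of $\mathbb{C}$ of finite degree over $\mathbb{Q}$, and $K_1\mathbf e_1+K_2\mathbf e_2=\{\gamma_1\mathbf e_1+\gamma_2\mathbf e_2:\gamma_k\in K_k\}\subset\mathbb{B}$. The degree of $L$ is $n=\dim_{\mathbb{Q}}L$. $\mathcal{O}_L$ is the set of elements of $L$ that are roots of a monic polynomial with coefficients in $\mathbb{Z}$; $\mathcal{O}_{K_k}$ is the usual ring of integers of $K_k$. *)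

theory Defs
  imports Complex_Main "HOL-Computational_Algebra.Polynomial"
begin

section \<open>Bicomplex numbers\<close>

text \<open>
  \<open>Bicomplex x y z t\<close> is $x + y\mathbf{i} + z\mathbf{j} + t\mathbf{k}$.
  The product is the one determined by $\mathbf{i}^2 = \mathbf{k}^2 = -1$,
  $\mathbf{j}^2 = 1$ and $\mathbf{i}\mathbf{j} = \mathbf{j}\mathbf{i} = \mathbf{k}$,
  whence $\mathbf{i}\mathbf{k} = -\mathbf{j}$ and $\mathbf{j}\mathbf{k} = \mathbf{i}$.
\<close>

codatatype bicomplex = Bicomplex (bc_re: real) (bc_i: real) (bc_j: real) (bc_k: real)

lemma bicomplex_eq_iff:
  "u = v \<longleftrightarrow> bc_re u = bc_re v \<and> bc_i u = bc_i v \<and> bc_j u = bc_j v \<and> bc_k u = bc_k v"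
  by (auto intro: bicomplex.expand)

instantiation bicomplex :: comm_ring_1
begin

primcorec zero_bicomplex where
  "bc_re 0 = 0"
| "bc_i 0 = 0"
| "bc_j 0 = 0"
| "bc_k 0 = 0"

primcorec one_bicomplex where
  "bc_re 1 = 1"
| "bc_i 1 = 0"
| "bc_j 1 = 0"
| "bc_k 1 = 0"

primcorec plus_bicomplex where
  "bc_re (u + v) = bc_re u + bc_re v"
| "bc_i (u + v) = bc_i u + bc_i v"
| "bc_j (u + v) = bc_j u + bc_j v"
| "bc_k (u + v) = bc_k u + bc_k v"

primcorec uminus_bicomplex where
  "bc_re (- u) = - bc_re u"
| "bc_i (- u) = - bc_i u"
| "bc_j (- u) = - bc_j u"
| "bc_k (- u) = - bc_k u"

primcorec minus_bicomplex where
  "bc_re (u - v) = bc_re u - bc_re v"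
| "bc_i (u - v) = bc_i u - bc_i v"
| "bc_j (u - v) = bc_j u - bc_j v"
| "bc_k (u - v) = bc_k u - bc_k v"

primcorec times_bicomplex where
  "bc_re (u * v) = bc_re u * bc_re v - bc_i u * bc_i v + bc_j u * bc_j v - bc_k u * bc_k v"
| "bc_i (u * v) = bc_re u * bc_i v + bc_i u * bc_re v + bc_j u * bc_k v + bc_k u * bc_j v"
| "bc_j (u * v) = bc_re u * bc_j v + bc_j u * bc_re v - bc_i u * bc_k v - bc_k u * bc_i v"
| "bc_k (u * v) = bc_re u * bc_k v + bc_k u * bc_re v + bc_i u * bc_j v + bc_j u * bc_i v"

instance
  by standard (simp_all add: bicomplex_eq_iff algebra_simps)

end

instantiation bicomplex :: real_algebra_1
begin

primcorec scaleR_bicomplex where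
  "bc_re (r *\<^sub>R u) = r * bc_re u"
| "bc_i (r *\<^sub>R u) = r * bc_i u"
| "bc_j (r *\<^sub>R u) = r * bc_j u"
| "bc_k (r *\<^sub>R u) = r * bc_k u"

instance
  by standard (simp_all add: bicomplex_eq_iff algebra_simps)

end

definition unit_i :: bicomplex where "unit_i = Bicomplex 0 1 0 0"
definition unit_j :: bicomplex where "unit_j = Bicomplex 0 0 1 0"
definition unit_k :: bicomplex where "unit_k = Bicomplex 0 0 0 1"

lemma Bicomplex_eq:
  "Bicomplex x y z t = of_real x + y *\<^sub>R unit_i + z *\<^sub>R unit_j + t *\<^sub>R unit_k"
  by (simp add: bicomplex_eq_iff of_real_def unit_i_def unit_j_def unit_k_def)

lemma unit_mult:
  "unit_i * unit_i = -1" "unit_k * unit_k = -1" "unit_j * unit_j = 1"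
  "unit_i * unit_j = unit_k" "unit_j * unit_i = unit_k"
  by (simp_all add: bicomplex_eq_iff unit_i_def unit_j_def unit_k_def)

text \<open>The identification of $\mathbb{C}$ with $\{x + y\mathbf{i}\}$.\<close>

definition bc_of_complex :: "complex \<Rightarrow> bicomplex" where
  "bc_of_complex z = of_real (Re z) + Im z *\<^sub>R unit_i"

definition e1 :: bicomplex where "e1 = (1/2) *\<^sub>R (1 + unit_j)"
definition e2 :: bicomplex where "e2 = (1/2) *\<^sub>R (1 - unit_j)"

definition idem :: "complex \<Rightarrow> complex \<Rightarrow> bicomplex" where
  "idem \<gamma>\<^sub>1 \<gamma>\<^sub>2 = bc_of_complex \<gamma>\<^sub>1 * e1 + bc_of_complex \<gamma>\<^sub>2 * e2"

definition idem_set :: "complex set \<Rightarrow> complex set \<Rightarrow> bicomplex set" where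
  "idem_set A B = {idem \<gamma>\<^sub>1 \<gamma>\<^sub>2 | \<gamma>\<^sub>1 \<gamma>\<^sub>2. \<gamma>\<^sub>1 \<in> A \<and> \<gamma>\<^sub>2 \<in> B}"


section \<open>Linear algebra over the rationals and the integers\<close>

definition rat_scale :: "rat \<Rightarrow> 'a \<Rightarrow> 'a::real_vector" where
  "rat_scale q x = of_rat q *\<^sub>R x"

global_interpretation rat_vec: vector_space "rat_scale :: rat \<Rightarrow> 'a \<Rightarrow> 'a::real_vector"
  by unfold_locales (simp_all add: rat_scale_def algebra_simps of_rat_add of_rat_mult)

definition int_scale :: "int \<Rightarrow> 'a \<Rightarrow> 'a::comm_ring_1" where
  "int_scale m x = of_int m * x"

global_interpretation int_mod: module "int_scale :: int \<Rightarrow> 'a \<Rightarrow> 'a::comm_ring_1"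
  by unfold_locales (simp_all add: int_scale_def algebra_simps)

definition free_int_module_of_rank :: "'a::comm_ring_1 set \<Rightarrow> nat \<Rightarrow> bool" where
  "free_int_module_of_rank M n \<longleftrightarrow>
     (\<exists>B. finite B \<and> card B = n \<and> int_mod.independent B \<and> int_mod.span B = M)"


section \<open>Number fields and rings of integers\<close>

definition number_field :: "complex set \<Rightarrow> bool" where
  "number_field K \<longleftrightarrow>
     0 \<in> K \<and> 1 \<in> K \<and>
     (\<forall>x\<in>K. \<forall>y\<in>K. x + y \<in> K \<and> x * y \<in> K) \<and>
     (\<forall>x\<in>K. - x \<in> K \<and> inverse x \<in> K) \<and>
     (\<exists>B. finite B \<and> rat_vec.span B = K)"

definition int_ring :: "complex set \<Rightarrow> complex set" where
  "int_ring K = {x \<in> K. algebraic_int x}"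

text \<open>
  \<^const>\<open>algebraic_int\<close> is only available over fields, so its defining condition
  is repeated here for the ring of bicomplex numbers.
\<close>

definition bc_int_ring :: "bicomplex set \<Rightarrow> bicomplex set" where
  "bc_int_ring L =
     {x \<in> L. \<exists>p. lead_coeff p = 1 \<and> (\<forall>i. coeff p i \<in> \<int>) \<and> poly p x = 0}"

end

theory Submission
  imports Defs
begin

text \<open>
  Writing bicomplex numbers in the idempotent components identifies the ring of bicomplex
  numbers with \<open>\<complex> \<times> \<complex>\<close>, and integral polynomials are evaluated componentwise. Hence an element is
  integral exactly if both of its components are (lemma \<open>bc_int_ring_idem_set\<close>); to annihilate both
  components at once one multiplies their monic polynomials. The uniqueness statements follow as
  the components of a bicomplex number are determined by it.

  The arithmetic part is that the ring of integers of a number field \<open>K\<close> is a finitely generated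
  abelian group (\<open>int_ring_finitely_generated\<close>). It rests on a single algebraic fact: every
  submodule of a finitely generated \<open>\<int>\<close>-module inside a rational vector space has a finite
  \<open>\<int>\<close>-basis (\<open>ex_int_basis_of_submodule\<close>). Through it, a number is an algebraic integer as soon as
  it maps a nonzero finitely generated module into itself (\<open>algebraic_int_if_stabilizes\<close>), which shows
  that algebraic integers form a ring and that every element of \<open>K\<close> has an integral multiple.
  It also provides, for an algebraic integer \<open>x\<close> of \<open>K\<close>, a basis of \<open>K\<close> in which multiplication by
  \<open>x\<close> has an integral matrix, so that the trace of \<open>x\<close> is an integer (\<open>mult_trace_in_Ints\<close>).
  The trace form is nondegenerate in characteristic zero, so traces against a basis of integral
  elements embed the ring of integers into some \<open>\<int>\<^sup>r\<close>.

  The ring of integers of the bicomplex extension is therefore contained in a finitely generated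
  module and has a \<open>\<int>\<close>-basis. Such a basis is independent over \<open>\<rat>\<close>
  (\<open>rat_independent_if_int_independent\<close>) and spans the extension over \<open>\<rat>\<close>
  (\<open>rat_span_idem_int_ring\<close>), so its cardinality is the degree.
\<close>

section \<open>Integral and rational linear algebra\<close>

lemma int_scale_eq_rat_scale:
  "int_scale m x = rat_scale (of_int m) (x :: 'a::{comm_ring_1,real_algebra_1})"
  by (simp add: int_scale_def rat_scale_def scaleR_conv_of_real)

lemma int_span_subset_rat_span:
  "int_mod.span S \<subseteq> rat_vec.span (S :: 'a::{comm_ring_1,real_algebra_1} set)"
  by (rule int_mod.span_minimal)
     (auto simp: int_mod.subspace_def int_scale_eq_rat_scale rat_vec.span_base rat_vec.span_zero
        intro: rat_vec.span_add rat_vec.span_scale)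

lemma ex_common_denominator:
  fixes S :: "rat set"
  assumes "finite S"
  shows "\<exists>D>0. \<forall>q\<in>S. of_int D * q \<in> \<int>"
  using assms
proof induction
  case empty
  show ?case by (rule exI[of _ 1]) simp
next
  case (insert q S)
  then obtain D where D: "D > 0" "\<forall>q\<in>S. of_int D * q \<in> \<int>" by blast
  obtain a b where ab: "q = of_int a / of_int b" "b > 0"
    by (cases q) (auto simp: Fract_of_int_quotient)
  have "of_int (b * D) * q = of_int (a * D)" using ab by simp
  then have "of_int (b * D) * q \<in> \<int>" by (simp only: Ints_of_int)
  moreover have "of_int (b * D) * r \<in> \<int>" if "r \<in> S" for r :: rat
    using D(2) that by (auto simp: mult.assoc)
  ultimately show ?case using D(1) ab(2)
    by (intro exI[of _ "b * D"]) (auto simp del: of_int_mult)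
qed

text \<open>
  A nontrivial rational relation becomes a nontrivial integral one once it is multiplied by a
  common denominator of its coefficients. This turns the cardinality of a \<open>\<int>\<close>-basis into a
  dimension over \<open>\<rat>\<close>.
\<close>

lemma rat_independent_if_int_independent:
  fixes B :: "'a::{comm_ring_1,real_algebra_1} set"
  assumes fin: "finite B" and ind: "int_mod.independent B"
  shows "rat_vec.independent B"
proof
  assume "rat_vec.dependent B"
  then obtain u v where v: "v \<in> B" "u v \<noteq> 0" and sum0: "(\<Sum>b\<in>B. rat_scale (u b) b) = 0"
    by (auto simp: rat_vec.dependent_finite[OF fin])
  obtain D where D: "D > 0" "\<And>b. b \<in> B \<Longrightarrow> of_int D * u b \<in> \<int>"
    using ex_common_denominator[of "u ` B"] fin by auto
  define w where "w = (\<lambda>b. \<lfloor>of_int D * u b\<rfloor>)"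
  have w: "of_int (w b) = of_int D * u b" if "b \<in> B" for b
    using D(2)[OF that] by (auto simp: w_def elim!: Ints_cases)
  have "(\<Sum>b\<in>B. int_scale (w b) b) = rat_scale (of_int D) (\<Sum>b\<in>B. rat_scale (u b) b)"
    by (simp add: int_scale_eq_rat_scale w rat_vec.scale_sum_right cong: sum.cong)
  also have "\<dots> = 0" by (simp add: sum0)
  finally have "(\<Sum>b\<in>B. int_scale (w b) b) = 0" .
  moreover have "w v \<noteq> 0" using w[OF v(1)] v(2) D(1) by (auto simp del: of_int_mult)
  ultimately show False using ind v(1) by (auto simp: int_mod.dependent_finite[OF fin])
qed

text \<open>
  A \<open>\<int>\<close>-module embedded in \<open>\<int>\<^sup>F\<close> is free of finite rank. Split off one functional \<open>f\<close> at a time: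
  its kernel \<open>N\<close> is separated by the remaining functionals, hence has a basis by induction, and
  its image is a subgroup of \<open>\<int>\<close>. An element \<open>m\<close> of the module whose value under \<open>f\<close> generates
  the image extends the basis of \<open>N\<close>. The functionals are only required to be additive on \<open>M\<close>,
  because coordinates with respect to a basis are additive only on the span of that basis.
\<close>

lemma ex_int_basis_if_separating_functionals:
  fixes M :: "'a::comm_ring_1 set" and F :: "('a \<Rightarrow> rat) set"
  assumes "finite F" and "int_mod.subspace M"
    and "\<And>f x. f \<in> F \<Longrightarrow> x \<in> M \<Longrightarrow> f x \<in> \<int>"
    and "\<And>f x y. f \<in> F \<Longrightarrow> x \<in> M \<Longrightarrow> y \<in> M \<Longrightarrow> f (x + y) = f x + f y"
    and "\<And>f m x. f \<in> F \<Longrightarrow> x \<in> M \<Longrightarrow> f (int_scale m x) = of_int m * f x"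
    and "\<And>x. x \<in> M \<Longrightarrow> (\<And>f. f \<in> F \<Longrightarrow> f x = 0) \<Longrightarrow> x = 0"
  shows "\<exists>B. finite B \<and> int_mod.independent B \<and> int_mod.span B = M"
  using assms
proof (induction F arbitrary: M)
  case empty
  then have "M = {0}" using int_mod.subspace_0 by auto
  then show ?case by (intro exI[of _ "{}"]) (auto simp: int_mod.dependent_finite)
next
  case (insert f F)
  note sub = insert.prems(1)
  have fint: "f x \<in> \<int>" if "x \<in> M" for x using insert.prems(2) that by blast
  have fadd: "f (x + y) = f x + f y" if "x \<in> M" "y \<in> M" for x y
    using insert.prems(3) that by blast
  have fscale: "f (int_scale m x) = of_int m * f x" if "x \<in> M" for m x
    using insert.prems(4) that by blast
  define N where "N = {x \<in> M. f x = 0}"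
  have f0: "f 0 = 0" using fscale[of 0 0] int_mod.subspace_0[OF sub] by simp
  have subN: "int_mod.subspace N"
    unfolding N_def using sub by (auto simp: int_mod.subspace_def f0 fadd fscale)
  have "\<exists>B. finite B \<and> int_mod.independent B \<and> int_mod.span B = N"
  proof (rule insert.IH[OF subN])
    fix x assume x: "x \<in> N" and "\<And>g. g \<in> F \<Longrightarrow> g x = 0"
    then have "g x = 0" if "g \<in> insert f F" for g using that by (auto simp: N_def)
    then show "x = 0" using insert.prems(5) x by (auto simp: N_def)
  qed (use insert.prems in \<open>auto simp: N_def\<close>)
  then obtain B where B: "finite B" "int_mod.independent B" "int_mod.span B = N" by blast
  show ?case
  proof (cases "N = M")
    case True
    then show ?thesis using B by blast
  next
    case False
    \<comment> \<open>The least positive value of \<open>f\<close> on \<open>M\<close> generates its image.\<close>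
    define P where "P = (\<lambda>k::nat. k > 0 \<and> (\<exists>x\<in>M. f x = of_nat k))"
    obtain x where x: "x \<in> M" "f x \<noteq> 0" using False by (auto simp: N_def)
    obtain a where a: "f x = of_int a" using fint[OF x(1)] by (auto elim: Ints_cases)
    have "P (nat \<bar>a\<bar>)"
    proof -
      have "f (int_scale (sgn a) x) = of_int (sgn a * a)"
        using a by (simp add: fscale[OF x(1)])
      also have "sgn a * a = int (nat \<bar>a\<bar>)" by (simp add: sgn_if)
      finally have "f (int_scale (sgn a) x) = of_nat (nat \<bar>a\<bar>)" by simp
      then show ?thesis unfolding P_def
        using a x int_mod.subspace_scale[OF sub x(1)] by auto
    qed
    then have "P (LEAST k. P k)" and least: "\<And>k. P k \<Longrightarrow> (LEAST k. P k) \<le> k"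
      by (auto intro: LeastI Least_le)
    then obtain d m where d: "d > 0" "m \<in> M" "f m = of_nat d" "d = (LEAST k. P k)"
      by (auto simp: P_def)
    have decomp: "\<exists>q. y - int_scale q m \<in> N" if y: "y \<in> M" for y
    proof -
      obtain z where z: "f y = of_int z" using fint[OF y] by (auto elim: Ints_cases)
      define q where "q = z div int d"
      let ?r = "y - int_scale q m"
      have rM: "?r \<in> M" using y d(2) sub
        by (intro int_mod.subspace_diff int_mod.subspace_scale)
      have "f ?r = f y - of_int q * f m"
        using fadd[OF y int_mod.subspace_scale[OF sub d(2)], of "- q"] fscale[OF d(2), of "- q"]
        by simp
      also have "\<dots> = of_int (z - q * int d)" using z d(3) by simp
      also have "z - q * int d = z mod int d" by (simp add: q_def minus_div_mult_eq_mod)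
      finally have fr: "f ?r = of_int (z mod int d)" .
      \<comment> \<open>Otherwise this remainder would be a positive value of \<open>f\<close> below \<open>d\<close>.\<close>
      have "z mod int d = 0"
      proof (rule ccontr)
        assume nz: "z mod int d \<noteq> 0"
        have pos: "0 \<le> z mod int d" "z mod int d < int d" using d(1) by auto
        then have "P (nat (z mod int d))"
          unfolding P_def using nz fr rM by (auto intro!: bexI[of _ ?r])
        from least[OF this] show False using pos d(4) by linarith
      qed
      then show ?thesis using fr rM by (auto simp: N_def intro!: exI[of _ q])
    qed
    have mB: "m \<notin> B" using B(3) int_mod.span_base[of m B] d(1,3) by (auto simp: N_def)
    have "int_mod.independent (insert m B)"
    proof -
      have "u v = 0" if eq: "(\<Sum>v\<in>insert m B. int_scale (u v) v) = 0" and v: "v \<in> insert m B" for u v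
      proof -
        have s: "(\<Sum>v\<in>B. int_scale (u v) v) \<in> N"
          unfolding B(3)[symmetric] by (intro int_mod.span_sum int_mod.span_scale int_mod.span_base)
        have "0 = f (int_scale (u m) m + (\<Sum>v\<in>B. int_scale (u v) v))"
          using eq f0 B(1) mB by simp
        also have "\<dots> = of_int (u m) * of_nat d"
          using s d(2,3) fadd[of "int_scale (u m) m"] fscale[OF d(2)] int_mod.subspace_scale[OF sub]
          by (simp add: N_def)
        finally have "u m = 0" using d(1) by simp
        moreover from this have "(\<Sum>v\<in>B. int_scale (u v) v) = 0" using eq B(1) mB by simp
        then have "\<forall>v\<in>B. u v = 0" using B(2) by (auto simp: int_mod.dependent_finite[OF B(1)])
        ultimately show ?thesis using v by auto
      qed
      then show ?thesis using B(1) by (auto simp: int_mod.dependent_finite)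
    qed
    moreover have "int_mod.span (insert m B) = M"
    proof
      have "insert m B \<subseteq> M" using d(2) B(3) int_mod.span_superset[of B] by (auto simp: N_def)
      then show "int_mod.span (insert m B) \<subseteq> M" using sub by (rule int_mod.span_minimal)
      show "M \<subseteq> int_mod.span (insert m B)"
        using decomp B(3) by (auto simp: int_mod.span_insert)
    qed
    ultimately show ?thesis using B(1) by (intro exI[of _ "insert m B"]) simp
  qed
qed


lemma mult_int_span:
  assumes "\<And>s. s \<in> S \<Longrightarrow> y * s \<in> int_mod.span T" and "v \<in> int_mod.span S"
  shows "y * v \<in> int_mod.span T"
  using assms(2)
proof (induction rule: int_mod.span_induct_alt)
  case base
  show ?case by (simp add: int_mod.span_zero)
next
  case (step m s v)
  have "y * (int_scale m s + v) = int_scale m (y * s) + y * v"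
    by (simp add: int_scale_def algebra_simps)
  then show ?case using step assms(1) by (simp add: int_mod.span_add int_mod.span_scale)
qed

lemma ex_int_multiple_in_int_span:
  fixes V S :: "'a::{comm_ring_1,real_algebra_1} set"
  assumes "finite V" and fin: "finite S" and "V \<subseteq> rat_vec.span S"
  shows "\<exists>D>0. \<forall>v\<in>V. of_int D * v \<in> int_mod.span S"
  using assms(1,3)
proof induction
  case empty
  show ?case by (rule exI[of _ 1]) simp
next
  case (insert v V)
  then obtain D where D: "D > 0" "\<And>w. w \<in> V \<Longrightarrow> of_int D * w \<in> int_mod.span S" by blast
  from insert.prems obtain u where u: "v = (\<Sum>s\<in>S. rat_scale (u s) s)"
    by (auto simp: rat_vec.span_finite[OF fin])
  obtain E where E: "E > 0" "\<And>s. s \<in> S \<Longrightarrow> of_int E * u s \<in> \<int>"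
    using ex_common_denominator[of "u ` S"] fin by auto
  define w where "w = (\<lambda>s. \<lfloor>of_int E * u s\<rfloor>)"
  have w: "of_int (w s) = of_int E * u s" if "s \<in> S" for s
    using E(2)[OF that] by (auto simp: w_def elim!: Ints_cases)
  have "of_int E * v = rat_scale (of_int E) v"
    using int_scale_eq_rat_scale[of E v] by (simp add: int_scale_def)
  also have "\<dots> = (\<Sum>s\<in>S. int_scale (w s) s)"
    by (simp add: u int_scale_eq_rat_scale w rat_vec.scale_sum_right cong: sum.cong)
  also have "\<dots> \<in> int_mod.span S"
    by (intro int_mod.span_sum int_mod.span_scale int_mod.span_base)
  finally have "of_int E * v \<in> int_mod.span S" .
  then have "of_int (E * D) * x \<in> int_mod.span S" if "x \<in> insert v V" for x
    using that D(2)[of x] int_mod.span_scale[of "of_int E * v" S D]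
      int_mod.span_scale[of "of_int D * x" S E]
    by (auto simp: int_scale_def mult_ac)
  then show ?case using D(1) E(1) by (intro exI[of _ "E * D"]) simp
qed

lemma representation_in_Ints:
  fixes C :: "'a::{comm_ring_1,real_algebra_1} set"
  assumes ind: "rat_vec.independent C" and x: "x \<in> int_mod.span C"
  shows "rat_vec.representation C x c \<in> \<int>"
proof -
  obtain t r where t: "finite t" "t \<subseteq> C" and x_eq: "x = (\<Sum>a\<in>t. int_scale (r a) a)"
    using x by (auto simp: int_mod.span_explicit)
  have tC: "a \<in> rat_vec.span C" if "a \<in> t" for a
    using that t(2) rat_vec.span_base by blast
  have "rat_vec.representation C x c =
      (\<Sum>a\<in>t. of_int (r a) * rat_vec.representation C a c)"
    by (simp add: x_eq int_scale_eq_rat_scale tC rat_vec.span_scale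
        rat_vec.representation_sum[OF ind] rat_vec.representation_scale[OF ind])
  also have "\<dots> \<in> \<int>" using t(2)
    by (intro Ints_sum Ints_mult) (auto simp: rat_vec.representation_basis[OF ind] subset_iff)
  finally show ?thesis .
qed

text \<open>
  The functionals needed above are the coordinates with respect to a rational basis \<open>C\<close> of the
  span of \<open>S\<close>, multiplied by one integer that clears the denominators of the elements of \<open>S\<close>.
  Since every submodule of a finitely generated module is covered, this serves both as the
  Noetherian property and as the freeness of finitely generated torsion-free modules.
\<close>

lemma ex_int_basis_of_submodule:
  fixes M S :: "'a::{comm_ring_1,real_algebra_1} set"
  assumes fin: "finite S" and sub: "int_mod.subspace M" and M: "M \<subseteq> int_mod.span S"
  shows "\<exists>B. finite B \<and> int_mod.independent B \<and> int_mod.span B = M"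
proof -
  obtain C where C: "C \<subseteq> S" "rat_vec.independent C" "S \<subseteq> rat_vec.span C"
    using rat_vec.maximal_independent_subset[of S] by blast
  have finC: "finite C" using C(1) fin finite_subset by blast
  define R where "R = rat_vec.representation C"
  have "int_mod.span S \<subseteq> rat_vec.span C"
    using int_span_subset_rat_span[of S] rat_vec.span_mono[OF C(3)] by (auto simp: rat_vec.span_span)
  then have MC: "x \<in> rat_vec.span C" if "x \<in> M" for x using that M by blast
  have Radd: "R (x + y) c = R x c + R y c" if "x \<in> M" "y \<in> M" for x y c
    using that by (simp add: R_def rat_vec.representation_add[OF C(2)] MC)
  have Rscale: "R (int_scale m x) c = of_int m * R x c" if "x \<in> M" for m x c
    using that by (simp add: R_def rat_vec.representation_scale[OF C(2)] MC int_scale_eq_rat_scale)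
  obtain D where D: "D > 0" "\<And>s. s \<in> S \<Longrightarrow> of_int D * s \<in> int_mod.span C"
    using ex_int_multiple_in_int_span[OF fin finC C(3)] by blast
  have int: "of_int D * R x c \<in> \<int>" if "x \<in> M" for x c
  proof -
    have "of_int D * x \<in> int_mod.span C" using mult_int_span[OF D(2)] that M by blast
    from representation_in_Ints[OF C(2) this, of c] show ?thesis
      using Rscale[OF that, of D c] by (simp add: R_def int_scale_def)
  qed
  show ?thesis
  proof (rule ex_int_basis_if_separating_functionals[of "(\<lambda>c x. of_int D * R x c) ` C"])
    fix x assume x: "x \<in> M" and "\<And>f. f \<in> (\<lambda>c x. of_int D * R x c) ` C \<Longrightarrow> f x = 0"
    then have "R x c = 0" if "c \<in> C" for c using that D(1) by force
    then show "x = 0"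
      using rat_vec.sum_representation_eq[OF C(2) MC finC order_refl, of x] x
      by (auto simp: R_def)
  qed (use finC sub int in \<open>auto simp: Radd Rscale algebra_simps\<close>)
qed

section \<open>Algebraic integers as stabilizers of finitely generated modules\<close>

text \<open>
  If \<open>x\<close> satisfies a monic integral equation of degree \<open>d\<close>, then \<open>x\<^sup>d\<close> is an integral combination
  of lower powers, so the products \<open>x\<^sup>i s\<close> with \<open>i < d\<close> and \<open>s \<in> S\<close> span a module that is mapped
  into itself by \<open>x\<close>. Any \<open>y\<close> that preserves the span of \<open>S\<close> preserves the larger module too, as
  \<open>y x\<^sup>i s = x\<^sup>i (y s)\<close>; this allows several algebraic integers to be adjoined in turn.
\<close>

lemma ex_stable_finite_set:
  fixes x :: "'a::real_field"
  assumes "algebraic_int x" and fin: "finite S"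
  obtains T where "finite T" and "S \<subseteq> T" and "\<And>t. t \<in> T \<Longrightarrow> \<exists>i. \<exists>s\<in>S. t = x ^ i * s"
    and "\<And>v. v \<in> int_mod.span T \<Longrightarrow> x * v \<in> int_mod.span T"
    and "\<And>y v. \<forall>s\<in>S. y * s \<in> int_mod.span S \<Longrightarrow> v \<in> int_mod.span T
           \<Longrightarrow> y * v \<in> int_mod.span T"
proof -
  from assms(1) obtain p where p: "poly (map_poly of_int p) x = 0" "lead_coeff p = 1"
    by (auto simp: algebraic_int_altdef_ipoly)
  define d where "d = degree p"
  have deg: "degree (map_poly of_int p :: 'a poly) = d" by (simp add: d_def degree_map_poly)
  have "0 = (\<Sum>i\<le>d. of_int (coeff p i) * x ^ i)"
    using p(1) by (simp add: poly_altdef deg coeff_map_poly)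
  also have "\<dots> = (\<Sum>i<d. of_int (coeff p i) * x ^ i) + x ^ d"
    using p(2) by (simp add: lessThan_Suc_atMost[symmetric] d_def)
  finally have xd: "x ^ d = (\<Sum>i<d. of_int (- coeff p i) * x ^ i)"
    by (simp add: sum_negf eq_neg_iff_add_eq_0 add.commute)
  have d0: "d > 0" using xd by (cases "d = 0") auto
  define T where "T = (\<lambda>(i, s). x ^ i * s) ` ({..<d} \<times> S)"
  have T: "x ^ i * s \<in> int_mod.span T" if "i < d" "s \<in> S" for i s
    using that by (auto simp: T_def intro!: int_mod.span_base)
  have "x * v \<in> int_mod.span T" if "v \<in> int_mod.span T" for v
  proof (rule mult_int_span[OF _ that])
    fix t assume "t \<in> T"
    then obtain i s where ij: "i < d" "s \<in> S" "t = x ^ i * s" by (auto simp: T_def)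
    show "x * t \<in> int_mod.span T"
    proof (cases "Suc i < d")
      case True
      then show ?thesis using T[OF True ij(2)] ij(3) by (simp add: mult.assoc)
    next
      case False
      then have "d = Suc i" using ij(1) by simp
      then have "x * t = x ^ d * s" using ij(3) by (simp add: mult.assoc)
      also have "\<dots> = (\<Sum>i<d. int_scale (- coeff p i) (x ^ i * s))"
        by (simp add: xd sum_distrib_right int_scale_def mult.assoc)
      also have "\<dots> \<in> int_mod.span T"
        using T ij(2) by (intro int_mod.span_sum int_mod.span_scale) auto
      finally show ?thesis .
    qed
  qed
  moreover have "y * v \<in> int_mod.span T"
    if y: "\<forall>s\<in>S. y * s \<in> int_mod.span S" and v: "v \<in> int_mod.span T" for y v
  proof (rule mult_int_span[OF _ v])
    fix t assume "t \<in> T"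
    then obtain i s where ij: "i < d" "s \<in> S" "t = x ^ i * s" by (auto simp: T_def)
    have "x ^ i * (y * s) \<in> int_mod.span T"
      by (rule mult_int_span[OF _ bspec[OF y ij(2)]]) (use T ij(1) in auto)
    then show "y * t \<in> int_mod.span T" using ij(3) by (simp add: mult_ac)
  qed
  moreover have "S \<subseteq> T"
    using d0 by (auto simp: T_def intro!: image_eqI[where x = "(0, s)" for s])
  ultimately show thesis using fin by (intro that[of T]) (auto simp: T_def)
qed

text \<open>
  Coefficients are indexed by \<open>k < n\<close> rather than by elements, since the family \<open>g\<close> may take a
  value twice, as the powers of a root of unity do.
\<close>

lemma int_span_image_lessThan:
  assumes "v \<in> int_mod.span (g ` {..<n::nat})"
  shows "\<exists>u. v = (\<Sum>k<n. int_scale (u k) (g k))"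
  using assms
proof (induction rule: int_mod.span_induct_alt)
  case base
  show ?case by (rule exI[of _ "\<lambda>_. 0"]) simp
next
  case (step m s v)
  then obtain u j where u: "v = (\<Sum>k<n. int_scale (u k) (g k))" and j: "j < n" "s = g j" by auto
  have "(\<Sum>k<n. int_scale (u k + (if k = j then m else 0)) (g k)) =
      (\<Sum>k<n. int_scale (u k) (g k)) + (\<Sum>k<n. if k = j then int_scale m (g k) else 0)"
    unfolding sum.distrib[symmetric] by (rule sum.cong) (auto simp: int_mod.scale_left_distrib)
  then have "int_scale m s + v = (\<Sum>k<n. int_scale (u k + (if k = j then m else 0)) (g k))"
    using j u by simp
  then show ?case by (rule exI[where x = "\<lambda>k. u k + (if k = j then m else 0)"])
qed

text \<open>
  The module generated by all \<open>z\<^sup>k w\<close> lies in a finitely generated one, so it is itself finitely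
  generated, and its generators involve only the powers below some \<open>n\<close>. Then \<open>z\<^sup>n w\<close> is an
  integral combination of the \<open>z\<^sup>k w\<close> with \<open>k < n\<close>; cancelling \<open>w\<close> gives a monic equation for \<open>z\<close>.
\<close>

lemma algebraic_int_if_stabilizes:
  fixes z w :: "'a::real_field"
  assumes fin: "finite S" and w: "w \<in> int_mod.span S" "w \<noteq> 0"
    and stable: "\<And>v. v \<in> int_mod.span S \<Longrightarrow> z * v \<in> int_mod.span S"
  shows "algebraic_int z"
proof -
  define g where "g = (\<lambda>k::nat. z ^ k * w)"
  define N where "N = (\<lambda>n. int_mod.span (g ` {..<n}))"
  have gS: "g k \<in> int_mod.span S" for k
    by (induction k) (use w stable in \<open>auto simp: g_def mult.assoc\<close>)
  have "int_mod.span (range g) \<subseteq> int_mod.span S"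
    using gS by (intro int_mod.span_minimal) (auto simp: int_mod.subspace_span)
  from ex_int_basis_of_submodule[OF fin int_mod.subspace_span this]
  obtain B where B: "finite B" "int_mod.span B = int_mod.span (range g)" by blast
  have mono: "N m \<subseteq> N n" if "m \<le> n" for m n
    using that unfolding N_def by (intro int_mod.span_mono image_mono) auto
  have ex: "\<exists>n. v \<in> N n" if "v \<in> int_mod.span (range g)" for v
    using that
  proof (induction rule: int_mod.span_induct_alt)
    case base
    show ?case by (auto simp: N_def int_mod.span_zero)
  next
    case (step m s v)
    then obtain n k where "v \<in> N n" "s = g k" by auto
    moreover have "g k \<in> N (Suc k)" by (auto simp: N_def intro: int_mod.span_base)
    ultimately have "v \<in> N (max n (Suc k))" "s \<in> N (max n (Suc k))"
      using mono[of n "max n (Suc k)"] mono[of "Suc k" "max n (Suc k)"] by auto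
    then show ?case unfolding N_def by (blast intro: int_mod.span_add int_mod.span_scale)
  qed
  have "\<exists>n. \<forall>b\<in>B. b \<in> N n"
  proof -
    have "\<forall>b\<in>B. \<exists>n. b \<in> N n" using ex B(2) int_mod.span_base by blast
    then obtain h where h: "\<And>b. b \<in> B \<Longrightarrow> b \<in> N (h b)" by metis
    show ?thesis
    proof (intro exI ballI)
      fix b assume b: "b \<in> B"
      show "b \<in> N (Max (h ` B))" using h[OF b] mono[of "h b" "Max (h ` B)"] b B(1) by auto
    qed
  qed
  then obtain n where "B \<subseteq> N n" by blast
  then have "int_mod.span B \<subseteq> N n"
    unfolding N_def by (intro int_mod.span_minimal) (auto simp: int_mod.subspace_span)
  moreover have "g n \<in> int_mod.span (range g)" by (auto intro: int_mod.span_base)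
  ultimately have "g n \<in> N n" using B(2) by blast
  then obtain u where "g n = (\<Sum>k<n. int_scale (u k) (g k))"
    unfolding N_def using int_span_image_lessThan by blast
  then have "z ^ n * w = (\<Sum>k<n. of_int (u k) * z ^ k) * w"
    by (simp add: g_def int_scale_def sum_distrib_right mult.assoc)
  then have zn: "z ^ n = (\<Sum>k<n. of_int (u k) * z ^ k)" using w(2) by simp
  define p where "p = monom (1::'a) n - (\<Sum>k<n. monom (of_int (u k)) k)"
  have coeff_p: "coeff p i = (if i = n then 1 else if i < n then - of_int (u i) else 0)" for i
    by (auto simp: p_def coeff_sum)
  have "degree p = n"
    by (intro antisym degree_le le_degree) (auto simp: coeff_p)
  then have "lead_coeff p = 1" by (simp add: coeff_p)
  moreover have "poly p z = 0" by (simp add: p_def poly_sum poly_monom zn)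
  ultimately show ?thesis by (intro algebraic_int.intros[of p]) (auto simp: coeff_p)
qed

text \<open>
  A module containing \<open>1\<close> that is preserved by both \<open>x\<close> and \<open>y\<close> is preserved by \<open>x + y\<close> and \<open>x y\<close>.
\<close>

lemma algebraic_int_add_mult:
  fixes x y :: "'a::real_field"
  assumes x: "algebraic_int x" and y: "algebraic_int y"
  shows "algebraic_int (x + y)" and "algebraic_int (x * y)"
proof -
  obtain S where S: "finite S" "{1} \<subseteq> S" "\<And>v. v \<in> int_mod.span S \<Longrightarrow> x * v \<in> int_mod.span S"
    by (rule ex_stable_finite_set[OF x finite.insertI[OF finite.emptyI]]) blast
  have xS: "\<forall>s\<in>S. x * s \<in> int_mod.span S" using S(3) int_mod.span_base by blast
  obtain T where T: "finite T" "S \<subseteq> T" "\<And>t. t \<in> T \<Longrightarrow> \<exists>i. \<exists>s\<in>S. t = y ^ i * s"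
    "\<And>v. v \<in> int_mod.span T \<Longrightarrow> y * v \<in> int_mod.span T"
    "\<And>z v. \<forall>s\<in>S. z * s \<in> int_mod.span S \<Longrightarrow> v \<in> int_mod.span T \<Longrightarrow> z * v \<in> int_mod.span T"
    by (fact ex_stable_finite_set[OF y S(1)])
  note xT = T(5)[OF xS]
  have one: "1 \<in> int_mod.span T" using S(2) T(2) by (auto intro: int_mod.span_base)
  show "algebraic_int (x + y)"
    by (rule algebraic_int_if_stabilizes[OF T(1) one])
       (auto simp: distrib_right intro: int_mod.span_add xT T(4))
  show "algebraic_int (x * y)"
    by (rule algebraic_int_if_stabilizes[OF T(1) one]) (auto simp: mult.assoc intro: xT T(4))
qed

section \<open>The trace of a multiplication map\<close>

text \<open>
  For a basis \<open>B\<close> of an algebra over \<open>\<rat>\<close> this is the trace of the matrix of multiplication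
  by \<open>x\<close>, that is, the usual field trace in the case of a number field.
\<close>

definition mult_trace :: "'a::{comm_ring_1,real_algebra_1} set \<Rightarrow> 'a \<Rightarrow> rat" where
  "mult_trace B x = (\<Sum>b\<in>B. rat_vec.representation B (x * b) b)"

lemma mult_rat_scale: "x * rat_scale q y = rat_scale q (x * y :: 'a::real_algebra_1)"
  by (simp add: rat_scale_def)

lemma rat_scale_mult: "rat_scale q x * y = rat_scale q (x * y :: 'a::real_algebra_1)"
  by (simp add: rat_scale_def)

lemma mult_trace_add:
  assumes "rat_vec.independent B" and "\<And>b. b \<in> B \<Longrightarrow> x * b \<in> rat_vec.span B"
    and "\<And>b. b \<in> B \<Longrightarrow> y * b \<in> rat_vec.span B"
  shows "mult_trace B (x + y) = mult_trace B x + mult_trace B y"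
  using assms
  by (simp add: mult_trace_def distrib_right rat_vec.representation_add sum.distrib)

lemma mult_trace_scale:
  assumes "rat_vec.independent B" and "\<And>b. b \<in> B \<Longrightarrow> x * b \<in> rat_vec.span B"
  shows "mult_trace B (rat_scale q x) = q * mult_trace B x"
  using assms
  by (simp add: mult_trace_def rat_scale_mult rat_vec.representation_scale sum_distrib_left)

lemma mult_trace_one: "rat_vec.independent B \<Longrightarrow> mult_trace B 1 = of_nat (card B)"
  by (simp add: mult_trace_def rat_vec.representation_basis)

text \<open>
  This is a product of matrices written in coordinates. With \<open>x = 1\<close> it is the change-of-basis
  formula from \<open>C\<close> to \<open>B\<close>.
\<close>

lemma representation_mult_expand:
  fixes B C :: "'a::{comm_ring_1,real_algebra_1} set"
  assumes B: "rat_vec.independent B"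
    and C: "finite C" "rat_vec.independent C" and v: "v \<in> rat_vec.span C"
    and x: "\<And>c. c \<in> C \<Longrightarrow> x * c \<in> rat_vec.span B"
  shows "rat_vec.representation B (x * v) b =
    (\<Sum>c\<in>C. rat_vec.representation C v c * rat_vec.representation B (x * c) b)"
proof -
  have "x * v = x * (\<Sum>c\<in>C. rat_scale (rat_vec.representation C v c) c)"
    by (simp add: rat_vec.sum_representation_eq[OF C(2) v C(1)])
  also have "\<dots> = (\<Sum>c\<in>C. rat_scale (rat_vec.representation C v c) (x * c))"
    by (simp add: sum_distrib_left mult_rat_scale)
  finally have "rat_vec.representation B (x * v) b =
    rat_vec.representation B (\<Sum>c\<in>C. rat_scale (rat_vec.representation C v c) (x * c)) b" by simp
  also have "\<dots> = (\<Sum>c\<in>C. rat_vec.representation C v c * rat_vec.representation B (x * c) b)"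
    using x by (simp add: rat_vec.representation_sum[OF B] rat_vec.representation_scale[OF B]
      rat_vec.span_scale)
  finally show ?thesis .
qed

text \<open>
  Let \<open>A\<close> be the matrix of multiplication by \<open>x\<close> from the basis \<open>B\<close> to the basis \<open>C\<close>, and \<open>P\<close> the
  change of basis from \<open>C\<close> to \<open>B\<close>. The two traces are \<open>tr (P A)\<close> and \<open>tr (A P)\<close>.
\<close>

lemma mult_trace_basis_independent:
  fixes B C :: "'a::{comm_ring_1,real_algebra_1} set"
  assumes B: "finite B" "rat_vec.independent B" and C: "finite C" "rat_vec.independent C"
    and eq: "rat_vec.span B = rat_vec.span C"
    and stable: "\<And>v. v \<in> rat_vec.span B \<Longrightarrow> x * v \<in> rat_vec.span B"
  shows "mult_trace B x = mult_trace C x"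
proof -
  let ?R = "rat_vec.representation"
  have inB: "b \<in> B \<Longrightarrow> b \<in> rat_vec.span B" "c \<in> C \<Longrightarrow> c \<in> rat_vec.span B" for b c
    using rat_vec.span_base eq by auto
  have "?R B (1 * (x * b)) b = (\<Sum>c\<in>C. ?R C (x * b) c * ?R B (1 * c) b)" if "b \<in> B" for b
    using that inB stable eq by (intro representation_mult_expand[OF B(2) C]) auto
  then have "mult_trace B x = (\<Sum>b\<in>B. \<Sum>c\<in>C. ?R C (x * b) c * ?R B c b)"
    by (simp add: mult_trace_def)
  also have "\<dots> = (\<Sum>c\<in>C. \<Sum>b\<in>B. ?R B c b * ?R C (x * b) c)"
    by (subst sum.swap) (simp add: mult.commute)
  also have "(\<Sum>b\<in>B. ?R B c b * ?R C (x * b) c) = ?R C (x * c) c" if "c \<in> C" for c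
    using that inB stable eq by (intro representation_mult_expand[OF C(2) B, symmetric]) auto
  then have "(\<Sum>c\<in>C. \<Sum>b\<in>B. ?R B c b * ?R C (x * b) c) = mult_trace C x"
    by (simp add: mult_trace_def)
  finally show ?thesis .
qed

text \<open>
  The trace may be computed in a basis adapted to \<open>x\<close>: a \<open>\<int>\<close>-basis of a finitely generated module
  that contains \<open>B\<close> and is preserved by \<open>x\<close>. It is also a rational basis of the span of \<open>B\<close>, and
  in it multiplication by \<open>x\<close> has an integral matrix.
\<close>

lemma mult_trace_in_Ints:
  fixes x :: "'a::real_field"
  assumes B: "finite B" "rat_vec.independent B" and x: "algebraic_int x"
    and stable: "\<And>v. v \<in> rat_vec.span B \<Longrightarrow> x * v \<in> rat_vec.span B"
  shows "mult_trace B x \<in> \<int>"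
proof -
  obtain T where T: "finite T" "B \<subseteq> T" "\<And>t. t \<in> T \<Longrightarrow> \<exists>i. \<exists>s\<in>B. t = x ^ i * s"
    "\<And>v. v \<in> int_mod.span T \<Longrightarrow> x * v \<in> int_mod.span T"
    using ex_stable_finite_set[OF x B(1)] by metis
  obtain C where C: "finite C" "int_mod.independent C" "int_mod.span C = int_mod.span T"
    using ex_int_basis_of_submodule[OF T(1) int_mod.subspace_span order_refl] by blast
  have indC: "rat_vec.independent C" by (rule rat_independent_if_int_independent[OF C(1,2)])
  have "x ^ i * s \<in> rat_vec.span B" if "s \<in> B" for i s
    by (induction i) (use that stable in \<open>auto simp: mult.assoc rat_vec.span_base\<close>)
  then have TB: "T \<subseteq> rat_vec.span B" using T(3) by blast
  have "rat_vec.span B = rat_vec.span C"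
  proof
    have "B \<subseteq> int_mod.span C" using T(2) C(3) int_mod.span_superset by blast
    then show "rat_vec.span B \<subseteq> rat_vec.span C"
      using int_span_subset_rat_span by (intro rat_vec.span_minimal) auto
    have "C \<subseteq> int_mod.span T" using C(3) int_mod.span_superset by blast
    also have "\<dots> \<subseteq> rat_vec.span T" by (rule int_span_subset_rat_span)
    also have "\<dots> \<subseteq> rat_vec.span B" using TB by (intro rat_vec.span_minimal) auto
    finally show "rat_vec.span C \<subseteq> rat_vec.span B" by (intro rat_vec.span_minimal) auto
  qed
  then have "mult_trace B x = mult_trace C x"
    by (rule mult_trace_basis_independent[OF B C(1) indC _ stable])
  also have "\<dots> \<in> \<int>"
    unfolding mult_trace_def using T(4) C(3) int_mod.span_base
    by (intro Ints_sum representation_in_Ints[OF indC]) blast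
  finally show ?thesis .
qed

section \<open>Rings of integers of number fields\<close>

lemma number_field_basis:
  assumes "number_field K"
  obtains B where "finite B" "rat_vec.independent B" "rat_vec.span B = K"
proof -
  obtain S where S: "finite S" "rat_vec.span S = K"
    using assms by (auto simp: number_field_def)
  obtain B where B: "B \<subseteq> S" "rat_vec.independent B" "S \<subseteq> rat_vec.span B"
    using rat_vec.maximal_independent_subset[of S] by blast
  have "rat_vec.span B = K"
    using rat_vec.span_mono[OF B(1)] rat_vec.span_minimal[OF B(3)] S(2) by auto
  then show thesis using that B S(1) finite_subset by blast
qed

lemma int_ring_subspace:
  assumes K: "number_field K"
  shows "int_mod.subspace (int_ring K)"
proof -
  obtain B where B: "rat_vec.span B = K" using number_field_basis[OF K] by blast
  have "int_scale m x \<in> K" if "x \<in> K" for m x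
    using that rat_vec.span_scale[of x B "of_int m"] by (simp add: B int_scale_eq_rat_scale)
  moreover have "algebraic_int (int_scale m x)" if "algebraic_int x" for m and x :: complex
    using algebraic_int_add_mult(2)[OF _ that, of "of_int m"] int_imp_algebraic_int[of "of_int m"]
    by (simp add: int_scale_def)
  ultimately show ?thesis
    using K algebraic_int_add_mult(1)
    by (auto simp: int_mod.subspace_def int_ring_def number_field_def)
qed

text \<open>
  Multiplication by \<open>x\<close> has a rational matrix in a basis \<open>B\<close> of \<open>K\<close>. If \<open>m\<close> clears its denominators,
  then \<open>m x\<close> preserves the \<open>\<int>\<close>-span of \<open>B\<close>, hence is an algebraic integer.
\<close>

lemma ex_integral_multiple:
  assumes K: "number_field K" and x: "x \<in> K"
  shows "\<exists>m>0. of_int m * x \<in> int_ring K"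
proof -
  obtain B where B: "finite B" "rat_vec.independent B" "rat_vec.span B = K"
    using number_field_basis[OF K] by blast
  have "(\<lambda>b. x * b) ` B \<subseteq> rat_vec.span B"
    using K x B(3) rat_vec.span_base[of _ B] by (auto simp: number_field_def)
  from ex_int_multiple_in_int_span[OF finite_imageI[OF B(1)] B(1) this]
  obtain m where m: "m > 0" "\<And>b. b \<in> B \<Longrightarrow> (of_int m * x) * b \<in> int_mod.span B"
    by (auto simp: mult.assoc)
  have "B \<noteq> {}" using B(3) K by (auto simp: number_field_def)
  then obtain b where b: "b \<in> B" by blast
  then have "b \<noteq> 0" using B(2) rat_vec.dependent_zero by blast
  then have "algebraic_int (of_int m * x)"
    using algebraic_int_if_stabilizes[OF B(1) int_mod.span_base[OF b]] mult_int_span[OF m(2)]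
    by blast
  moreover have "of_int m * x \<in> K"
    using rat_vec.span_scale[of x B "of_int m"] x B(3)
    by (simp flip: int_scale_eq_rat_scale add: int_scale_def)
  ultimately show ?thesis using m(1) by (auto simp: int_ring_def)
qed

text \<open>
  Choose a basis of \<open>K\<close> whose members \<open>m\<^sub>b b\<close> are algebraic integers. The functionals
  \<open>x \<mapsto> tr (x m\<^sub>b b)\<close> are integral on the ring of integers. They separate its elements because
  the trace form is nondegenerate: for \<open>x \<noteq> 0\<close> the trace of \<open>x x\<^sup>-\<^sup>1 = 1\<close> is the degree of \<open>K\<close>,
  which is not zero.
\<close>

lemma int_ring_finitely_generated:
  assumes K: "number_field K"
  obtains C where "finite C" and "int_mod.span C = int_ring K"
proof -
  obtain B where B: "finite B" "rat_vec.independent B" "rat_vec.span B = K"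
    using number_field_basis[OF K] by blast
  have mult: "x * y \<in> K" if "x \<in> K" "y \<in> K" for x y using K that by (auto simp: number_field_def)
  have BK: "b \<in> K" if "b \<in> B" for b using that B(3) rat_vec.span_base by blast
  have "\<forall>b\<in>B. \<exists>m>0. of_int m * b \<in> int_ring K" using ex_integral_multiple[OF K] BK by blast
  then obtain m where m: "\<And>b. b \<in> B \<Longrightarrow> m b > 0" "\<And>b. b \<in> B \<Longrightarrow> of_int (m b) * b \<in> int_ring K"
    by metis
  define f where "f = (\<lambda>b x. mult_trace B (x * (of_int (m b) * b)))"
  have OK: "x \<in> K" if "x \<in> int_ring K" for x using that by (simp add: int_ring_def)
  have add: "mult_trace B (x + y) = mult_trace B x + mult_trace B y" if "x \<in> K" "y \<in> K" for x y
    using that mult BK by (intro mult_trace_add) (auto simp: B)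
  have scale: "mult_trace B (rat_scale q x) = q * mult_trace B x" if "x \<in> K" for q x
    using that mult BK by (intro mult_trace_scale) (auto simp: B)
  have "\<exists>C. finite C \<and> int_mod.independent C \<and> int_mod.span C = int_ring K"
  proof (rule ex_int_basis_if_separating_functionals[of "f ` B"])
    show "finite (f ` B)" using B(1) by simp
    show "int_mod.subspace (int_ring K)" by (rule int_ring_subspace[OF K])
  next
    fix g x assume g: "g \<in> f ` B" and x: "x \<in> int_ring K"
    then obtain b where b: "b \<in> B" "g = f b" by blast
    have "algebraic_int (x * (of_int (m b) * b))"
      using algebraic_int_add_mult(2)[of x "of_int (m b) * b"] x m(2)[OF b(1)]
      by (simp add: int_ring_def)
    moreover have prodK: "x * (of_int (m b) * b) \<in> K" using x m(2)[OF b(1)] OK mult by blast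
    ultimately show "g x \<in> \<int>"
      unfolding b(2) f_def using mult B by (intro mult_trace_in_Ints) auto
    show "g (int_scale k x) = of_int k * g x" for k
      using scale[OF prodK, of "of_int k"] by (simp add: b(2) f_def int_scale_eq_rat_scale rat_scale_mult)
    show "g (x + y) = g x + g y" if "y \<in> int_ring K" for y
    proof -
      have "y * (of_int (m b) * b) \<in> K" using that m(2)[OF b(1)] OK mult by blast
      from add[OF prodK this] show ?thesis by (simp add: b(2) f_def distrib_right)
    qed
  next
    fix x assume x: "x \<in> int_ring K" and zero: "\<And>g. g \<in> f ` B \<Longrightarrow> g x = 0"
    note xK = OK[OF x]
    have zb: "mult_trace B (x * b) = 0" if b: "b \<in> B" for b
    proof -
      have "x * (of_int (m b) * b) = rat_scale (of_int (m b)) (x * b)"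
        by (simp add: rat_scale_def scaleR_conv_of_real)
      then have "of_int (m b) * mult_trace B (x * b) = f b x"
        using scale[OF mult[OF xK BK[OF b]], of "of_int (m b)"] by (simp add: f_def)
      also have "\<dots> = 0" using zero b by blast
      finally show ?thesis using m(1)[OF b] by simp
    qed
    have zK: "y \<in> rat_vec.span B \<and> mult_trace B (x * y) = 0" if "y \<in> rat_vec.span B" for y
      using that
    proof (induction rule: rat_vec.span_induct_alt)
      case base
      then show ?case by (simp add: mult_trace_def rat_vec.representation_zero rat_vec.span_zero)
    next
      case (step c b y)
      have "rat_scale c b \<in> K" using step(1) B(3) rat_vec.span_base rat_vec.span_scale by blast
      moreover have "mult_trace B (x * rat_scale c b) = 0"
        using scale[OF mult[OF xK BK[OF step(1)]], of c] zb[OF step(1)] by (simp add: mult_rat_scale)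
      moreover have "y \<in> K" "mult_trace B (x * y) = 0" using step(2) B(3) by auto
      ultimately show ?case
        using add[of "x * rat_scale c b" "x * y"] mult[OF xK] rat_vec.span_add[of "rat_scale c b" B y] B(3)
        by (simp add: distrib_left)
    qed
    show "x = 0"
    proof (rule ccontr)
      assume "x \<noteq> 0"
      moreover have "inverse x \<in> K" using K xK by (auto simp: number_field_def)
      ultimately have "of_nat (card B) = (0::rat)"
        using zK[of "inverse x"] mult_trace_one[OF B(2)] B(3) by simp
      then have "B = {}" using B(1) by simp
      then show False using B(3) K by (auto simp: number_field_def)
    qed
  qed
  then show thesis using that by blast
qed

section \<open>Idempotent components\<close>

lemma idem_simps [simp]:
  "bc_re (idem a b) = (Re a + Re b) / 2"
  "bc_i (idem a b) = (Im a + Im b) / 2"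
  "bc_j (idem a b) = (Re a - Re b) / 2"
  "bc_k (idem a b) = (Im a - Im b) / 2"
  by (simp_all add: idem_def bc_of_complex_def e1_def e2_def of_real_def unit_i_def unit_j_def
      field_simps)

lemma idem_eq_iff [simp]: "idem a b = idem c d \<longleftrightarrow> a = c \<and> b = d"
proof
  assume "idem a b = idem c d"
  then have "Re a + Re b = Re c + Re d" "Re a - Re b = Re c - Re d"
    "Im a + Im b = Im c + Im d" "Im a - Im b = Im c - Im d"
    by (simp_all add: bicomplex_eq_iff)
  then show "a = c \<and> b = d" unfolding complex_eq_iff by linarith
qed simp

lemma ex_idem:
  obtains a b where "x = idem a b"
proof
  show "x = idem (Complex (bc_re x + bc_j x) (bc_i x + bc_k x))
      (Complex (bc_re x - bc_j x) (bc_i x - bc_k x))"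
    by (simp add: bicomplex_eq_iff)
qed

lemma idem_mem_idem_set_iff [simp]: "idem a b \<in> idem_set A B \<longleftrightarrow> a \<in> A \<and> b \<in> B"
  by (auto simp: idem_set_def)

lemma idem_add: "idem a b + idem c d = idem (a + c) (b + d)"
  by (simp add: bicomplex_eq_iff field_simps)

lemma idem_mult: "idem a b * idem c d = idem (a * c) (b * d)"
proof -
  have e: "e1 * e1 = e1" "e2 * e2 = e2" "e1 * e2 = 0" "e2 * e1 = 0"
    by (simp_all add: bicomplex_eq_iff e1_def e2_def unit_j_def)
  have hom: "bc_of_complex (x * y) = bc_of_complex x * bc_of_complex y" for x y
    by (simp add: bicomplex_eq_iff bc_of_complex_def of_real_def unit_i_def)
  have "idem a b * idem c d =
      bc_of_complex a * bc_of_complex c * (e1 * e1) + bc_of_complex a * bc_of_complex d * (e1 * e2)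
      + bc_of_complex b * bc_of_complex c * (e2 * e1) + bc_of_complex b * bc_of_complex d * (e2 * e2)"
    by (simp only: idem_def distrib_left distrib_right mult_ac add_ac)
  also have "\<dots> = idem (a * c) (b * d)" by (simp add: e hom idem_def)
  finally show ?thesis .
qed

lemma rat_scale_idem: "rat_scale q (idem a b) = idem (rat_scale q a) (rat_scale q b)"
  by (simp add: bicomplex_eq_iff rat_scale_def field_simps)

lemma int_scale_idem: "int_scale m (idem a b) = idem (int_scale m a) (int_scale m b)"
  by (simp add: int_scale_eq_rat_scale rat_scale_idem)

lemma idem_zero: "idem 0 0 = 0"
  by (simp add: bicomplex_eq_iff)

lemma of_int_idem: "of_int m = idem (of_int m) (of_int m)"
proof -
  have "idem 1 1 = 1" by (simp add: bicomplex_eq_iff)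
  then show ?thesis using int_scale_idem[of m 1 1] by (simp add: int_scale_def)
qed

lemma poly_idem:
  "poly (map_poly of_int p) (idem a b) =
    idem (poly (map_poly of_int p) a) (poly (map_poly of_int p) b)"
proof (induction p)
  case 0
  show ?case by (simp add: idem_zero)
next
  case (pCons c p)
  then show ?case
    by (simp add: map_poly_pCons of_int_idem[of c] idem_add idem_mult)
qed

text \<open>
  Lifting the coefficients to \<open>\<int>\<close> lets one polynomial be evaluated at bicomplex and at complex
  arguments, and makes degrees of products additive in spite of the bicomplex zero divisors.
\<close>

lemma ex_int_poly:
  fixes p :: "'a::ring_char_0 poly"
  assumes "\<forall>i. coeff p i \<in> \<int>"
  obtains q where "p = map_poly of_int q"
proof -
  obtain c where c: "\<And>i. coeff p i = of_int (c i)"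
    using assms by (auto simp: Ints_def image_iff choice_iff)
  have "p = map_poly of_int (\<Sum>i\<le>degree p. monom (c i) i)"
  proof (rule poly_eqI)
    fix n
    have "c n = 0" if "n > degree p" using coeff_eq_0[OF that] unfolding c by simp
    then have "coeff (\<Sum>i\<le>degree p. monom (c i) i) n = c n"
      by (auto simp: coeff_sum)
    then show "coeff p n = coeff (map_poly of_int (\<Sum>i\<le>degree p. monom (c i) i)) n"
      by (simp add: coeff_map_poly c)
  qed
  then show thesis using that by blast
qed

lemma bc_int_ring_alt:
  "x \<in> bc_int_ring L \<longleftrightarrow> x \<in> L \<and> (\<exists>p. lead_coeff p = 1 \<and> poly (map_poly of_int p) x = 0)"
proof -
  have "(\<exists>p::bicomplex poly. lead_coeff p = 1 \<and> (\<forall>i. coeff p i \<in> \<int>) \<and> poly p x = 0) \<longleftrightarrow>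
    (\<exists>q::int poly. lead_coeff q = 1 \<and> poly (map_poly of_int q) x = 0)" (is "?A \<longleftrightarrow> ?B")
  proof
    assume ?A
    then obtain p :: "bicomplex poly" where p: "lead_coeff p = 1" "\<forall>i. coeff p i \<in> \<int>" "poly p x = 0"
      by blast
    obtain q where "p = map_poly of_int q" using ex_int_poly[OF p(2)] by blast
    then show ?B using p by (auto simp: degree_map_poly coeff_map_poly)
  next
    assume ?B
    then obtain q :: "int poly" where "lead_coeff q = 1" "poly (map_poly of_int q) x = 0" by blast
    then show ?A
      by (intro exI[of _ "map_poly of_int q"]) (auto simp: degree_map_poly coeff_map_poly)
  qed
  then show ?thesis by (simp add: bc_int_ring_def)
qed

text \<open>
  Evaluation of an integral polynomial is componentwise, so a monic polynomial annihilating \<open>x\<close>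
  annihilates both components. Conversely, if \<open>p\<close> and \<open>q\<close> annihilate the first and the second
  component, then the monic polynomial \<open>p q\<close> annihilates both.
\<close>

lemma bc_int_ring_idem_set:
  "bc_int_ring (idem_set K1 K2) = idem_set (int_ring K1) (int_ring K2)"
proof -
  have int_iff: "(\<exists>p. lead_coeff p = 1 \<and> poly (map_poly of_int p) (idem a b) = 0) \<longleftrightarrow>
      algebraic_int a \<and> algebraic_int b" (is "?P \<longleftrightarrow> ?Q") for a b
  proof
    assume ?P
    then show ?Q by (auto simp: poly_idem idem_zero[symmetric] algebraic_int_altdef_ipoly)
  next
    assume ?Q
    then obtain p q where p: "poly (map_poly of_int p) a = 0" "lead_coeff p = 1"
      and q: "poly (map_poly of_int q) b = 0" "lead_coeff q = 1"
      by (auto simp: algebraic_int_altdef_ipoly)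
    have "map_poly of_int (p * q) = (map_poly of_int p * map_poly of_int q :: complex poly)"
      by (rule poly_eqI) (simp add: coeff_map_poly coeff_mult)
    then have "poly (map_poly of_int (p * q)) (idem a b) = 0"
      using p(1) q(1) by (simp add: poly_idem idem_zero)
    moreover have "lead_coeff (p * q) = 1" using p(2) q(2) by (simp add: lead_coeff_mult)
    ultimately show ?P by blast
  qed
  show ?thesis
  proof (rule set_eqI)
    fix x
    obtain a b where x: "x = idem a b" by (rule ex_idem)
    show "x \<in> bc_int_ring (idem_set K1 K2) \<longleftrightarrow> x \<in> idem_set (int_ring K1) (int_ring K2)"
      unfolding x bc_int_ring_alt int_iff by (auto simp: int_ring_def)
  qed
qed

lemma idem_set_subspace:
  assumes "int_mod.subspace A" and "int_mod.subspace B"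
  shows "int_mod.subspace (idem_set A B)"
  unfolding int_mod.subspace_def
proof (intro conjI allI ballI)
  show "0 \<in> idem_set A B"
    using assms by (auto simp: idem_set_def int_mod.subspace_def idem_zero[symmetric] simp del: idem_eq_iff)
  show "x + y \<in> idem_set A B" if "x \<in> idem_set A B" "y \<in> idem_set A B" for x y
    using that assms by (auto simp: idem_set_def int_mod.subspace_def idem_add)
  show "int_scale c x \<in> idem_set A B" if "x \<in> idem_set A B" for c x
    using that assms by (auto simp: idem_set_def int_mod.subspace_def int_scale_idem)
qed

lemma idem_set_eq_iff:
  assumes "A \<noteq> {}" "B \<noteq> {}"
  shows "idem_set A B = idem_set C D \<longleftrightarrow> A = C \<and> B = D"
proof
  assume eq: "idem_set A B = idem_set C D"
  have "a \<in> A \<and> b \<in> B \<longleftrightarrow> a \<in> C \<and> b \<in> D" for a b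
    unfolding idem_mem_idem_set_iff[symmetric] by (simp only: eq)
  then show "A = C \<and> B = D" using assms by blast
qed simp

lemma idem_set_finitely_generated:
  assumes "finite A" "finite B"
  shows "\<exists>E. finite E \<and> idem_set (int_mod.span A) (int_mod.span B) \<subseteq> int_mod.span E"
proof (intro exI conjI subsetI)
  let ?E = "(\<lambda>a. idem a 0) ` A \<union> (\<lambda>b. idem 0 b) ` B"
  show "finite ?E" using assms by simp
  have left: "idem a 0 \<in> int_mod.span ?E" if "a \<in> int_mod.span A" for a
    using that
  proof (induction rule: int_mod.span_induct_alt)
    case base
    show ?case by (simp add: idem_zero int_mod.span_zero)
  next
    case (step m s a)
    have "idem (int_scale m s + a) 0 = int_scale m (idem s 0) + idem a 0"
      by (simp add: int_scale_idem idem_add)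
    moreover have "idem s 0 \<in> int_mod.span ?E" using step(1) by (intro int_mod.span_base) auto
    ultimately show ?case using step(2) by (metis int_mod.span_add int_mod.span_scale)
  qed
  have right: "idem 0 b \<in> int_mod.span ?E" if "b \<in> int_mod.span B" for b
    using that
  proof (induction rule: int_mod.span_induct_alt)
    case base
    show ?case by (simp add: idem_zero int_mod.span_zero)
  next
    case (step m s b)
    have "idem 0 (int_scale m s + b) = int_scale m (idem 0 s) + idem 0 b"
      by (simp add: int_scale_idem idem_add)
    moreover have "idem 0 s \<in> int_mod.span ?E" using step(1) by (intro int_mod.span_base) auto
    ultimately show ?case using step(2) by (metis int_mod.span_add int_mod.span_scale)
  qed
  fix x assume "x \<in> idem_set (int_mod.span A) (int_mod.span B)"
  then obtain a b where "x = idem a b" "a \<in> int_mod.span A" "b \<in> int_mod.span B"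
    by (auto simp: idem_set_def)
  then show "x \<in> int_mod.span ?E"
    using int_mod.span_add[OF left right] by (simp add: idem_add)
qed

text \<open>
  Every element of the bicomplex extension has a positive integral multiple with both components
  algebraic integers, so a \<open>\<int>\<close>-basis of the ring of integers has the degree of the extension as
  its cardinality.
\<close>

lemma rat_span_idem_int_ring:
  assumes K: "number_field K1" "number_field K2"
  shows "rat_vec.span (idem_set (int_ring K1) (int_ring K2)) = idem_set K1 K2"
proof
  obtain B1 B2 where B: "rat_vec.span B1 = K1" "rat_vec.span B2 = K2"
    using number_field_basis K by metis
  have "rat_vec.subspace (idem_set K1 K2)"
    unfolding rat_vec.subspace_def
  proof (intro conjI allI ballI)
    have "idem 0 0 \<in> idem_set K1 K2"
      using K by (auto simp: idem_set_def number_field_def)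
    then show "0 \<in> idem_set K1 K2" by (simp only: idem_zero)
    show "x + y \<in> idem_set K1 K2" if "x \<in> idem_set K1 K2" "y \<in> idem_set K1 K2" for x y
      using that K by (auto simp: idem_set_def number_field_def idem_add)
    show "rat_scale c x \<in> idem_set K1 K2" if "x \<in> idem_set K1 K2" for c x
      using that B rat_vec.span_scale by (auto simp: idem_set_def rat_scale_idem)
  qed
  moreover have "idem_set (int_ring K1) (int_ring K2) \<subseteq> idem_set K1 K2"
    by (auto simp: idem_set_def int_ring_def)
  ultimately show "rat_vec.span (idem_set (int_ring K1) (int_ring K2)) \<subseteq> idem_set K1 K2"
    by (intro rat_vec.span_minimal)
  show "idem_set K1 K2 \<subseteq> rat_vec.span (idem_set (int_ring K1) (int_ring K2))"
  proof
    fix x assume "x \<in> idem_set K1 K2"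
    then obtain a b where x: "x = idem a b" "a \<in> K1" "b \<in> K2" by (auto simp: idem_set_def)
    obtain k m where k: "k > 0" "int_scale k a \<in> int_ring K1" and m: "m > 0" "int_scale m b \<in> int_ring K2"
      using ex_integral_multiple[OF K(1) x(2)] ex_integral_multiple[OF K(2) x(3)]
      by (auto simp: int_scale_def)
    have "int_scale m (int_scale k a) \<in> int_ring K1" "int_scale k (int_scale m b) \<in> int_ring K2"
      using k m int_ring_subspace K int_mod.subspace_scale by blast+
    then have "int_scale (k * m) x \<in> idem_set (int_ring K1) (int_ring K2)"
      by (auto simp: x(1) idem_set_def int_scale_idem mult.commute)
    then have "rat_scale (1 / of_int (k * m)) (int_scale (k * m) x) \<in>
        rat_vec.span (idem_set (int_ring K1) (int_ring K2))"
      by (intro rat_vec.span_scale rat_vec.span_base)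
    then show "x \<in> rat_vec.span (idem_set (int_ring K1) (int_ring K2))"
      using k(1) m(1) by (simp add: int_scale_eq_rat_scale)
  qed
qed

section \<open>The ring of integers of a bicomplex extension\<close>

theorem theorem4p2:
  fixes K1 K2 :: "complex set" and L :: "bicomplex set" and n :: nat
  assumes "number_field K1" and "number_field K2"
    and "L = idem_set K1 K2"
    and "rat_vec.dim L = n"
  shows "bc_int_ring L = idem_set (int_ring K1) (int_ring K2)
    \<and> (\<forall>x \<in> bc_int_ring L.
         \<exists>!\<gamma>. fst \<gamma> \<in> int_ring K1 \<and> snd \<gamma> \<in> int_ring K2 \<and> x = idem (fst \<gamma>) (snd \<gamma>))
    \<and> (\<forall>A B. bc_int_ring L = idem_set A B \<longrightarrow> A = int_ring K1 \<and> B = int_ring K2)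
    \<and> free_int_module_of_rank (bc_int_ring L) n
    \<and> \<int> \<subseteq> bc_int_ring L"
proof (intro conjI)
  show eq: "bc_int_ring L = idem_set (int_ring K1) (int_ring K2)"
    by (simp add: assms(3) bc_int_ring_idem_set)
  show "\<forall>x \<in> bc_int_ring L.
      \<exists>!\<gamma>. fst \<gamma> \<in> int_ring K1 \<and> snd \<gamma> \<in> int_ring K2 \<and> x = idem (fst \<gamma>) (snd \<gamma>)"
    unfolding eq by (auto simp: idem_set_def)
  have sub: "int_mod.subspace (int_ring K1)" "int_mod.subspace (int_ring K2)"
    using int_ring_subspace assms(1,2) by blast+
  have "int_ring K1 \<noteq> {}" "int_ring K2 \<noteq> {}"
    using int_mod.subspace_0[OF sub(1)] int_mod.subspace_0[OF sub(2)] by blast+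
  then show "\<forall>A B. bc_int_ring L = idem_set A B \<longrightarrow> A = int_ring K1 \<and> B = int_ring K2"
    unfolding eq by (auto simp: idem_set_eq_iff)
  show "free_int_module_of_rank (bc_int_ring L) n"
  proof -
    obtain C1 where C1: "finite C1" "int_mod.span C1 = int_ring K1"
      using int_ring_finitely_generated[OF assms(1)] by blast
    obtain C2 where C2: "finite C2" "int_mod.span C2 = int_ring K2"
      using int_ring_finitely_generated[OF assms(2)] by blast
    obtain E where E: "finite E" "bc_int_ring L \<subseteq> int_mod.span E"
      using idem_set_finitely_generated[OF C1(1) C2(1)] unfolding eq C1(2) C2(2) by blast
    have "int_mod.subspace (bc_int_ring L)"
      unfolding eq using sub by (rule idem_set_subspace)
    then obtain B where B: "finite B" "int_mod.independent B" "int_mod.span B = bc_int_ring L"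
      using ex_int_basis_of_submodule[OF E(1) _ E(2)] by blast
    have "rat_vec.span (bc_int_ring L) = L"
      unfolding eq using rat_span_idem_int_ring[OF assms(1,2)] assms(3) by simp
    moreover have "rat_vec.span (int_mod.span B) = rat_vec.span B"
    proof
      show "rat_vec.span (int_mod.span B) \<subseteq> rat_vec.span B"
        by (intro rat_vec.span_minimal int_span_subset_rat_span) simp
      show "rat_vec.span B \<subseteq> rat_vec.span (int_mod.span B)"
        by (intro rat_vec.span_mono int_mod.span_superset)
    qed
    ultimately have "L = rat_vec.span B" by (simp add: B(3))
    then have "n = card B"
      using assms(4) rat_vec.dim_span_eq_card_independent[OF rat_independent_if_int_independent[OF B(1,2)]]
      by simp
    then show ?thesis using B by (auto simp: free_int_module_of_rank_def)
  qed
  show "\<int> \<subseteq> bc_int_ring L"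
  proof
    fix x :: bicomplex assume "x \<in> \<int>"
    then obtain m where x: "x = of_int m" by (elim Ints_cases)
    have "of_int m \<in> int_ring K" if K: "number_field K" for K
    proof -
      obtain B where B: "rat_vec.span B = K" using number_field_basis[OF K] by blast
      have "rat_scale (of_int m) 1 \<in> K"
        using K B rat_vec.span_scale[of 1 B] by (auto simp: number_field_def)
      moreover have "rat_scale (of_int m) 1 = (of_int m :: complex)"
        using int_scale_eq_rat_scale[of m "1 :: complex"] by (simp add: int_scale_def)
      ultimately show ?thesis by (simp add: int_ring_def int_imp_algebraic_int)
    qed
    then show "x \<in> bc_int_ring L"
      unfolding eq using assms(1,2) by (auto simp: x of_int_idem idem_set_def)
  qed
qed

end
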